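(* Let $X$, $Y$, $Z$ be locally convex Hausdorff topological vector spaces, and let $F\colon X \rightrightarrows Y$ be a multifunction whose graph is given by $$\mathrm{gph}\,F=\big\{(x,y)\in X\times Y \;\big|\; A_1(x)+A_2(y)=z,\ \langle x_i^*,x\rangle+\langle y_i^*,y\rangle\le \beta_i,\ i=1,\dots,m\big\},$$ where $A_1\colon X\to Z$ and $A_2\colon Y\to Z$ are continuous linear mappings, $z\in Z$, and $x_i^*\in X^*$, $y_i^*\in Y^*$, $\beta_i\in\mathbb{R}$ for $i=1,\dots,m$. If the mapping $A_2$ is closed under finite-codimensional subspaces, then $\mathrm{dom}\,F$ is a generalized polyhedral convex set in $X$.
   Context: All vector spaces are real. $X^*$ denotes the topological dual of $X$ and $\langle x^*,x\rangle$ the value of $x^*\in X^*$ at $x\in X$. A multifunction $F\colon X\rightrightarrows Y$ assigns to each $x\in X$ a (possibly empty) subset $F(x)\subset Y$; $\mathrm{dom}\,F=\{x\in X\mid F(x)\neq\emptyset\}$ and $\mathrm{gph}\,F=\{(x,y)\in X\times Y\mid y\in F(x)\}$. A subset $D$ of a locally convex Hausdorff topological vector space $X$ is a generalized polyhedral convex set if there exist finitely many $x_i^*\in X^*$, $\alpha_i\in\mathbb{R}$, $i=1,\dots,m$, and a closed affine subspace $L\subset X$ such that $D=\{x\in X\mid x\in L,\ \langle x_i^*,x\rangle\le\alpha_i,\ i=1,\dots,m\}$. The empty set counts as generalized polyhedral convex. A continuous linear mapping $A\colon Y\to Z$ is closed under finite-codimensional subspaces if $A(Y_0)$ is closed in $Z$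 for every closed linear subspace $Y_0\subset Y$ of finite codimension (i.e. $\dim(Y/Y_0)<\infty$). *)

theory Defs
  imports "HOL-Analysis.Analysis" "HOL-Library.Set_Algebras"
begin

class locally_convex_space = real_vector + topological_ab_group_add + t2_space +
  assumes tendsto_scaleR_Pair_lcs:
    "LIM p (nhds r \<times>\<^sub>F nhds x). fst p *\<^sub>R snd p :> nhds (r *\<^sub>R x)"
  and convex_nhds_base_zero:
    "open U \<Longrightarrow> 0 \<in> U \<Longrightarrow>
      \<exists>V T. (\<forall>x\<in>V. \<forall>y\<in>V. \<forall>u\<ge>0. \<forall>v\<ge>0. u + v = 1 \<longrightarrow> u *\<^sub>R x + v *\<^sub>R y \<in> V) \<and>
        open T \<and> 0 \<in> T \<and> T \<subseteq> V \<and> V \<subseteq> U"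

text \<open>The constant \<^const>\<open>convex\<close> cannot be used in a class specification, so its
  definition is written out above.\<close>

lemma convex_nhds_zero:
  fixes U :: "'a::locally_convex_space set"
  assumes "open U" "0 \<in> U"
  shows "\<exists>V. convex V \<and> 0 \<in> interior V \<and> V \<subseteq> U"
  using convex_nhds_base_zero[OF assms] unfolding convex_def interior_def by blast

instance real_normed_vector \<subseteq> locally_convex_space
proof
  fix r :: real and x :: 'a
  show "LIM p (nhds r \<times>\<^sub>F nhds x). fst p *\<^sub>R snd p :> nhds (r *\<^sub>R x)"
    unfolding nhds_prod[symmetric]
    by (intro tendsto_intros tendsto_fst[OF filterlim_ident, of "(r, x)", simplified]
        tendsto_snd[OF filterlim_ident, of "(r, x)", simplified])
next
  fix U :: "'a set"
  assume "open U" "0 \<in> U"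
  then obtain e where "e > 0" "ball 0 e \<subseteq> U"
    by (auto simp: open_contains_ball)
  then show "\<exists>V T. (\<forall>x\<in>V. \<forall>y\<in>V. \<forall>u\<ge>0. \<forall>v\<ge>0. u + v = 1 \<longrightarrow> u *\<^sub>R x + v *\<^sub>R y \<in> V) \<and>
      open T \<and> 0 \<in> T \<and> T \<subseteq> V \<and> V \<subseteq> U"
    by (intro exI[of _ "ball 0 e"])
      (use convex_ball[of "0::'a" e] in \<open>simp only: convex_def centre_in_ball open_ball
        subset_refl simp_thms\<close>)
qed

definition continuous_linear ::
    "('a::locally_convex_space \<Rightarrow> 'b::locally_convex_space) \<Rightarrow> bool" where
  "continuous_linear f \<longleftrightarrow> linear f \<and> continuous_on UNIV f"

definition topological_dual :: "('a::locally_convex_space \<Rightarrow> real) set" where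
  "topological_dual = {f. continuous_linear f}"

definition mdom :: "('a \<Rightarrow> 'b set) \<Rightarrow> 'a set" where
  "mdom F = {x. F x \<noteq> {}}"

definition gph :: "('a \<Rightarrow> 'b set) \<Rightarrow> ('a \<times> 'b) set" where
  "gph F = {(x, y). y \<in> F x}"

text \<open>Since \<^term>\<open>affine {}\<close> holds, the affine set \<open>L\<close> may be empty here; this
  yields only the empty set, which counts as generalized polyhedral convex. The number \<open>m\<close>
  of inequalities may be zero.\<close>

definition generalized_polyhedral_convex :: "'a::locally_convex_space set \<Rightarrow> bool" where
  "generalized_polyhedral_convex D \<longleftrightarrow>
    (\<exists>(m::nat) (x' :: nat \<Rightarrow> 'a \<Rightarrow> real) (\<alpha> :: nat \<Rightarrow> real) L.
      (\<forall>i\<in>{1..m}. x' i \<in> topological_dual) \<and> affine L \<and> closed L \<and>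
      D = {x. x \<in> L \<and> (\<forall>i\<in>{1..m}. x' i x \<le> \<alpha> i)})"

text \<open>For a subspace \<open>W\<close>, the quotient by \<open>W\<close> is represented by the set of cosets. Its zero is
  \<open>W\<close>, its addition is the Minkowski sum of \<^theory>\<open>HOL-Library.Set_Algebras\<close>. In its scalar
  multiplication, adding \<open>W\<close> matters only for the scalar \<open>0\<close>, where the image of a coset
  would be \<open>{0}\<close> instead of \<open>W\<close>. Likewise, \<open>W\<close> is added to the linear combinations below
  because the empty Minkowski sum is \<open>{0}\<close>.\<close>

definition quotient_space :: "'a::real_vector set \<Rightarrow> 'a set set" where
  "quotient_space W = range (\<lambda>y. {y} + W)"

definition quotient_scale :: "'a::real_vector set \<Rightarrow> real \<Rightarrow> 'a set \<Rightarrow> 'a set" where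
  "quotient_scale W r C = (\<lambda>x. r *\<^sub>R x) ` C + W"

definition finite_codimension :: "'a::real_vector set \<Rightarrow> bool" where
  "finite_codimension W \<longleftrightarrow>
    (\<exists>S. finite S \<and> S \<subseteq> quotient_space W \<and>
      (\<forall>D \<in> quotient_space W. \<exists>r. D = W + (\<Sum>C\<in>S. quotient_scale W (r C) C)))"

definition closed_under_finite_codim ::
    "('a::locally_convex_space \<Rightarrow> 'b::locally_convex_space) \<Rightarrow> bool" where
  "closed_under_finite_codim A \<longleftrightarrow>
    (\<forall>W. subspace W \<and> closed W \<and> finite_codimension W \<longrightarrow> closed (A ` W))"

lemma quotient_add:
  assumes "subspace W"
  shows "({x} + W) + ({y} + W) = {x + y} + W"
proof -
  have WW: "W + W = W"
    using assms by (auto simp: set_plus_def subspace_add) (metis add_0 subspace_0)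
  have "({x} + W) + ({y} + W) = ({x} + {y}) + (W + W)"
    by (simp only: ac_simps)
  also have "{x} + {y} = {x + y}"
    by (auto simp: set_plus_def)
  finally show ?thesis by (simp only: WW)
qed

lemma mem_coset_iff: "z \<in> {x} + W \<longleftrightarrow> z - x \<in> W" for x :: "'a::real_vector"
  by (auto simp: set_plus_def) (metis add.commute diff_add_cancel)

lemma coset_eq_iff:
  assumes "subspace W"
  shows "{x} + W = {y} + W \<longleftrightarrow> x - y \<in> W"
proof
  assume "{x} + W = {y} + W"
  moreover have "x \<in> {x} + W" using subspace_0[OF assms] by (simp add: mem_coset_iff)
  ultimately show "x - y \<in> W" by (simp add: mem_coset_iff)
next
  assume *: "x - y \<in> W"
  have "z - x \<in> W \<longleftrightarrow> z - y \<in> W" for z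
    using subspace_add[OF assms _ *, of "z - x"] subspace_diff[OF assms _ *, of "z - y"] by auto
  then show "{x} + W = {y} + W" by (auto simp: mem_coset_iff)
qed

lemma quotient_scale_coset:
  assumes "subspace W"
  shows "quotient_scale W r ({x} + W) = {r *\<^sub>R x} + W"
proof (intro set_eqI iffI)
  fix z assume "z \<in> quotient_scale W r ({x} + W)"
  then obtain v w where vw: "v \<in> W" "w \<in> W" "z = r *\<^sub>R (x + v) + w"
    by (auto simp: quotient_scale_def elim!: set_plus_elim)
  have "z - r *\<^sub>R x = r *\<^sub>R v + w" using vw(3) by (simp add: scaleR_add_right)
  then show "z \<in> {r *\<^sub>R x} + W"
    using vw(1,2) assms by (simp only: mem_coset_iff subspace_add subspace_scale)
next
  fix z assume "z \<in> {r *\<^sub>R x} + W"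
  moreover have "x \<in> {x} + W" using subspace_0[OF assms] by (simp add: mem_coset_iff)
  ultimately show "z \<in> quotient_scale W r ({x} + W)"
    unfolding quotient_scale_def by (auto elim!: set_plus_elim intro!: set_plus_intro)
qed

lemma quotient_sum:
  assumes "subspace W" "finite S" "\<And>C. C \<in> S \<Longrightarrow> C = {b C} + W"
  shows "W + (\<Sum>C\<in>S. quotient_scale W (r C) C) = {\<Sum>C\<in>S. r C *\<^sub>R b C} + W"
  using assms(2,3)
proof (induction S rule: finite_induct)
  case empty
  show ?case by (simp add: add.commute flip: set_zero)
next
  case (insert C S)
  have CS: "quotient_scale W (r C) C = {r C *\<^sub>R b C} + W"
    by (subst insert.prems[OF insertI1]) (rule quotient_scale_coset[OF assms(1)])
  have IH: "W + (\<Sum>D\<in>S. quotient_scale W (r D) D) = {\<Sum>D\<in>S. r D *\<^sub>R b D} + W"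
    by (rule insert.IH) (rule insert.prems[OF insertI2])
  have "W + (\<Sum>D\<in>insert C S. quotient_scale W (r D) D)
      = quotient_scale W (r C) C + (W + (\<Sum>D\<in>S. quotient_scale W (r D) D))"
    by (simp only: sum.insert[OF insert.hyps] add.left_commute)
  also have "\<dots> = ({r C *\<^sub>R b C} + W) + ({\<Sum>D\<in>S. r D *\<^sub>R b D} + W)"
    by (simp only: CS IH)
  also have "\<dots> = {r C *\<^sub>R b C + (\<Sum>D\<in>S. r D *\<^sub>R b D)} + W"
    by (rule quotient_add[OF assms(1)])
  finally show ?case by (simp only: sum.insert[OF insert.hyps])
qed

lemma finite_codimension_iff_span:
  assumes "subspace W"
  shows "finite_codimension W \<longleftrightarrow> (\<exists>B. finite B \<and> span (W \<union> B) = UNIV)"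
proof
  assume "finite_codimension W"
  then obtain S where S: "finite S" "S \<subseteq> quotient_space W"
    "\<And>D. D \<in> quotient_space W \<Longrightarrow> \<exists>r. D = W + (\<Sum>C\<in>S. quotient_scale W (r C) C)"
    unfolding finite_codimension_def by metis
  from S(2) have "\<forall>C\<in>S. \<exists>b. C = {b} + W"
    by (auto simp: quotient_space_def)
  then obtain b where b: "\<And>C. C \<in> S \<Longrightarrow> C = {b C} + W"
    by metis
  have "y \<in> span (W \<union> b ` S)" for y
  proof -
    have "{y} + W \<in> quotient_space W" by (auto simp: quotient_space_def)
    from S(3)[OF this] obtain r where
      "{y} + W = W + (\<Sum>C\<in>S. quotient_scale W (r C) C)" by blast
    with quotient_sum[OF assms S(1) b, of r]
    have "y - (\<Sum>C\<in>S. r C *\<^sub>R b C) \<in> W"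
      by (simp add: coset_eq_iff[OF assms])
    moreover have "(\<Sum>C\<in>S. r C *\<^sub>R b C) \<in> span (W \<union> b ` S)"
      by (intro span_sum span_scale span_base) auto
    ultimately show ?thesis
      by (metis UnI1 diff_add_cancel span_add span_base)
  qed
  then show "\<exists>B. finite B \<and> span (W \<union> B) = UNIV"
    using S(1) by (intro exI[of _ "b ` S"]) auto
next
  assume "\<exists>B. finite B \<and> span (W \<union> B) = UNIV"
  then obtain B where B: "finite B" "span (W \<union> B) = UNIV" by blast
  define S where "S = (\<lambda>y. {y} + W) ` B"
  have fS: "finite S" using B by (simp add: S_def)
  define b where "b C = (SOME y. C = {y} + W)" for C
  have b: "C = {b C} + W" if "C \<in> S" for C
    unfolding b_def by (rule someI_ex) (use that in \<open>auto simp: S_def\<close>)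
  have span_b: "span (W \<union> b ` S) = UNIV"
  proof -
    have "y \<in> span (W \<union> b ` S)" if "y \<in> B" for y
    proof -
      have "{y} + W \<in> S" using that by (simp add: S_def)
      from b[OF this] have "y - b ({y} + W) \<in> W" by (simp add: coset_eq_iff[OF assms])
      moreover have "b ({y} + W) \<in> span (W \<union> b ` S)"
        using \<open>{y} + W \<in> S\<close> by (intro span_base) auto
      ultimately show ?thesis by (metis UnI1 diff_add_cancel span_add span_base)
    qed
    then have "W \<union> B \<subseteq> span (W \<union> b ` S)" by (auto intro: span_base)
    then have "span (W \<union> B) \<subseteq> span (W \<union> b ` S)" by (simp add: span_minimal)
    with B show ?thesis by auto
  qed
  have "\<exists>r. D = W + (\<Sum>C\<in>S. quotient_scale W (r C) C)" if "D \<in> quotient_space W" for D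
  proof -
    from that obtain y where y: "D = {y} + W" by (auto simp: quotient_space_def)
    have "y \<in> span (W \<union> b ` S)" using span_b by simp
    then obtain w v where wv: "w \<in> W" "v \<in> span (b ` S)" "y = w + v"
      using assms by (auto simp: span_Un span_eq_iff[THEN iffD2])
    have inj: "inj_on b S" by (metis b inj_onI)
    from wv(2) obtain u where "v = (\<Sum>x\<in>b ` S. u x *\<^sub>R x)"
      using fS by (auto simp: span_finite)
    then have v: "v = (\<Sum>C\<in>S. u (b C) *\<^sub>R b C)"
      by (simp add: sum.reindex[OF inj])
    have "D = {v} + W" using y wv by (simp add: coset_eq_iff[OF assms])
    then have "D = W + (\<Sum>C\<in>S. quotient_scale W (u (b C)) C)"
      unfolding v using quotient_sum[OF assms fS b, of "\<lambda>C. u (b C)"] by simp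
    then show ?thesis by (rule exI[of _ "\<lambda>C. u (b C)"])
  qed
  then show "finite_codimension W"
    unfolding finite_codimension_def using fS
    by (intro exI[of _ S]) (auto simp: S_def quotient_space_def)
qed

end

theory Submission
  imports Defs
begin

text \<open>
  A point \<open>x\<close> lies in the domain iff some \<open>y\<close> satisfies \<open>A\<^sub>2 y = z - A\<^sub>1 x\<close> and finitely many
  inequalities. The equation is solvable iff \<open>x\<close> belongs to \<open>L = {x. z - A\<^sub>1 x \<in> range A\<^sub>2}\<close>,
  which is affine and is closed because the range of \<open>A\<^sub>2\<close> is closed (the whole space has
  codimension \<open>0\<close>). If \<open>y0\<close> is one solution, the others are \<open>y0 + y\<close> with \<open>y\<close> in the kernel \<open>K\<close> of
  \<open>A\<^sub>2\<close>, so it remains to decide whether the system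
  \<open>y' i y \<le> \<beta> i - x' i x - y' i y0\<close> is solvable in \<open>K\<close>.

  Only the values of finitely many functionals on \<open>K\<close> matter, so \<open>K\<close> may be replaced by a
  finite-dimensional subspace, and Fourier-Motzkin elimination of its generators
  (\<open>eliminate_subspace\<close>) turns solvability into finitely many linear inequalities for the
  right-hand side, with coefficient vectors \<open>u\<close> for which \<open>\<phi> = (\<Sum>i. u i * y' i)\<close> vanishes on \<open>K\<close>.

  The remaining difficulty is that these inequalities involve \<open>\<phi> y0\<close>, where \<open>y0\<close> need not
  depend continuously on \<open>x\<close>. As \<open>\<phi>\<close> vanishes on \<open>K\<close>, the number \<open>\<phi> y0\<close> depends only on
  \<open>A\<^sub>2 y0 = z - A\<^sub>1 x\<close>. The kernel of \<open>\<phi>\<close> is closed and has codimension at most \<open>1\<close>, so by hypothesis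
  its image under \<open>A\<^sub>2\<close> is closed; separating a point from this image by the Hahn-Banach theorem
  (\<open>closed_subspace_separation\<close>) gives a continuous functional \<open>\<mu>\<close> with \<open>\<mu> (A\<^sub>2 y) = \<phi> y\<close> for all
  \<open>y\<close> (\<open>functional_factors_through\<close>). Now \<open>\<phi> y0 = \<mu> z - \<mu> (A\<^sub>1 x)\<close>, and each inequality bounds a
  continuous linear functional of \<open>x\<close>.
\<close>

section \<open>Elimination of variables from finite systems of inequalities\<close>

lemma real_between_finite_sets:
  fixes A B :: "real set"
  assumes "finite A" "finite B" "\<And>a b. a \<in> A \<Longrightarrow> b \<in> B \<Longrightarrow> a \<le> b"
  shows "\<exists>t. (\<forall>a\<in>A. a \<le> t) \<and> (\<forall>b\<in>B. t \<le> b)"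
proof (cases "A = {}")
  case True
  then show ?thesis
    using assms(2) by (cases "B = {}") (auto intro!: exI[of _ "Min B"])
next
  case False
  then show ?thesis
    using assms by (intro exI[of _ "Max A"]) auto
qed

text \<open>
  The Fourier-Motzkin step: the constraints with \<open>b l < 0\<close> are lower bounds for \<open>t\<close>, those with
  \<open>b l > 0\<close> are upper bounds, and a value in between exists iff each lower bound is at most each
  upper bound.
\<close>

lemma eliminate_one_variable:
  fixes a b :: "'l \<Rightarrow> real"
  assumes "finite S"
  shows "(\<exists>t. \<forall>l\<in>S. t * b l \<le> a l) \<longleftrightarrow>
    (\<forall>l\<in>S. b l = 0 \<longrightarrow> 0 \<le> a l) \<and>
    (\<forall>p\<in>S. \<forall>n\<in>S. 0 < b p \<longrightarrow> b n < 0 \<longrightarrow> 0 \<le> b p * a n - b n * a p)"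
    (is "?L \<longleftrightarrow> ?R")
proof
  assume ?L
  then obtain t where t: "\<And>l. l \<in> S \<Longrightarrow> t * b l \<le> a l" by blast
  have "0 \<le> b p * a n - b n * a p" if "p \<in> S" "n \<in> S" "0 < b p" "b n < 0" for p n
  proof -
    have "b p * (t * b n) \<le> b p * a n" using t[OF that(2)] that(3) by simp
    moreover have "b n * a p \<le> b n * (t * b p)" using t[OF that(1)] that(4) by simp
    ultimately show ?thesis by (simp add: mult.left_commute mult.commute)
  qed
  then show ?R using t by force
next
  assume R: ?R
  have "\<exists>t. (\<forall>s\<in>(\<lambda>n. a n / b n) ` {n\<in>S. b n < 0}. s \<le> t) \<and>
      (\<forall>s\<in>(\<lambda>p. a p / b p) ` {p\<in>S. 0 < b p}. t \<le> s)"
  proof (rule real_between_finite_sets)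
    fix s s'
    assume "s \<in> (\<lambda>n. a n / b n) ` {n\<in>S. b n < 0}" "s' \<in> (\<lambda>p. a p / b p) ` {p\<in>S. 0 < b p}"
    then obtain n p where np: "n \<in> S" "b n < 0" "s = a n / b n" "p \<in> S" "0 < b p" "s' = a p / b p"
      by auto
    then have "0 \<le> b p * a n - b n * a p" using R by blast
    with np have "a p * b n \<le> a n * b p" by (simp add: mult.commute)
    then show "s \<le> s'"
      unfolding np(3,6) using np(2,5) by (simp add: divide_simps mult.commute)
  qed (use assms in auto)
  then obtain t where t: "\<And>n. n \<in> S \<Longrightarrow> b n < 0 \<Longrightarrow> a n / b n \<le> t"
    "\<And>p. p \<in> S \<Longrightarrow> 0 < b p \<Longrightarrow> t \<le> a p / b p" by blast
  have "t * b l \<le> a l" if "l \<in> S" for l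
  proof (cases "b l" "0::real" rule: linorder_cases)
    case less
    with t(1)[OF that] show ?thesis by (simp add: field_simps)
  next
    case equal
    with R that show ?thesis by auto
  next
    case greater
    with t(2)[OF that] show ?thesis by (simp add: field_simps)
  qed
  then show ?L by blast
qed

text \<open>
  Along a generator \<open>e\<close>, replacing \<open>y\<close> by \<open>y + t *\<^sub>R e\<close> changes the right-hand side \<open>c\<close> by a
  multiple of the vector of the \<open>g i e\<close>, so one Fourier-Motzkin step disposes of one generator.
  The set \<open>S\<close> does not depend on \<open>c\<close>; this uniformity is what makes it usable for a right-hand side
  that varies with the parameter of a multifunction.
\<close>

lemma eliminate_span:
  fixes g :: "'i \<Rightarrow> 'y::real_vector \<Rightarrow> real"
  assumes "finite I" "\<And>i. i \<in> I \<Longrightarrow> linear (g i)" "finite E"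
  shows "\<exists>S::('i \<Rightarrow> real) set. finite S \<and>
    (\<forall>c. (\<exists>y\<in>span E. \<forall>i\<in>I. g i y \<le> c i) \<longleftrightarrow> (\<forall>u\<in>S. 0 \<le> (\<Sum>i\<in>I. u i * c i)))"
  using assms(3)
proof (induction E rule: finite_induct)
  case empty
  \<comment> \<open>For \<open>y = 0\<close> the conditions are \<open>0 \<le> c j\<close>, given by the unit coefficient vectors.\<close>
  let ?S = "(\<lambda>j i. if i = j then 1 else 0::real) ` I"
  have "(\<Sum>i\<in>I. (if i = j then 1 else 0) * c i) = c j" if "j \<in> I" for j and c :: "'i \<Rightarrow> real"
    using that assms(1) by (simp add: if_distrib[of "\<lambda>x. x * _"] cong: if_cong)
  moreover have "g i 0 = 0" if "i \<in> I" for i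
    using assms(2)[OF that] by (rule linear_0)
  ultimately show ?case
    using assms(1) by (intro exI[of _ ?S]) auto
next
  case (insert e E)
  then obtain S :: "('i \<Rightarrow> real) set" where S: "finite S"
    "\<And>c. (\<exists>y\<in>span E. \<forall>i\<in>I. g i y \<le> c i) \<longleftrightarrow> (\<forall>u\<in>S. 0 \<le> (\<Sum>i\<in>I. u i * c i))" by blast
  define b where "b u = (\<Sum>i\<in>I. u i * g i e)" for u
  define S' where "S' = {u\<in>S. b u = 0} \<union>
    (\<lambda>(p, n) i. b p * n i - b n * p i) ` ({p\<in>S. 0 < b p} \<times> {n\<in>S. b n < 0})"
  have "(\<exists>y\<in>span (insert e E). \<forall>i\<in>I. g i y \<le> c i) \<longleftrightarrow> (\<forall>u\<in>S'. 0 \<le> (\<Sum>i\<in>I. u i * c i))" for c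
  proof -
    define a where "a u = (\<Sum>i\<in>I. u i * c i)" for u
    have split: "g i y \<le> c i \<longleftrightarrow> g i (y - t *\<^sub>R e) \<le> c i - t * g i e" if "i \<in> I" for i y t
      using assms(2)[OF that] by (simp add: linear_diff linear_scale)
    have "(\<exists>y\<in>span (insert e E). \<forall>i\<in>I. g i y \<le> c i) \<longleftrightarrow>
        (\<exists>t. \<exists>y\<in>span E. \<forall>i\<in>I. g i y \<le> c i - t * g i e)"
    proof
      assume "\<exists>y\<in>span (insert e E). \<forall>i\<in>I. g i y \<le> c i"
      then obtain y t where "y - t *\<^sub>R e \<in> span E" "\<forall>i\<in>I. g i y \<le> c i"
        by (auto simp: span_insert)
      then show "\<exists>t. \<exists>y\<in>span E. \<forall>i\<in>I. g i y \<le> c i - t * g i e" using split by blast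
    next
      assume "\<exists>t. \<exists>y\<in>span E. \<forall>i\<in>I. g i y \<le> c i - t * g i e"
      then obtain t y where ty: "y \<in> span E" "\<And>i. i \<in> I \<Longrightarrow> g i y \<le> c i - t * g i e" by blast
      have "g i (y + t *\<^sub>R e) \<le> c i" if "i \<in> I" for i
        using ty(2)[OF that] split[OF that, of "y + t *\<^sub>R e" t] by simp
      moreover have "y + t *\<^sub>R e \<in> span (insert e E)"
        using ty(1) by (auto simp: span_insert intro!: exI[of _ t])
      ultimately show "\<exists>y\<in>span (insert e E). \<forall>i\<in>I. g i y \<le> c i" by blast
    qed
    also have "\<dots> \<longleftrightarrow> (\<exists>t. \<forall>u\<in>S. t * b u \<le> a u)"
      unfolding S(2) a_def b_def
      by (simp add: right_diff_distrib sum_subtractf sum_distrib_left mult.left_commute)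
    also have "\<dots> \<longleftrightarrow> (\<forall>u\<in>S. b u = 0 \<longrightarrow> 0 \<le> a u) \<and>
        (\<forall>p\<in>S. \<forall>n\<in>S. 0 < b p \<longrightarrow> b n < 0 \<longrightarrow> 0 \<le> b p * a n - b n * a p)"
      by (rule eliminate_one_variable[OF S(1)])
    also have "\<dots> \<longleftrightarrow> (\<forall>u\<in>S'. 0 \<le> a u)"
    proof -
      have "a (\<lambda>i. b p * n i - b n * p i) = b p * a n - b n * a p" for p n
        unfolding a_def
        by (simp add: left_diff_distrib sum_subtractf sum_distrib_left mult.assoc)
      then show ?thesis unfolding S'_def by (simp add: ball_Un) blast
    qed
    finally show ?thesis unfolding a_def .
  qed
  moreover have "finite S'" using S(1) by (simp add: S'_def)
  ultimately show ?case by blast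
qed

text \<open>
  Finitely many functionals have a finite-dimensional joint image. The induction splits off one
  functional \<open>g j\<close>: unless it vanishes on \<open>K\<close>, a single \<open>e\<close> with \<open>g j e \<noteq> 0\<close> complements its kernel.
\<close>

lemma finite_spanning_for_functionals:
  fixes g :: "'i \<Rightarrow> 'y::real_vector \<Rightarrow> real"
  assumes "finite I" "\<And>i. i \<in> I \<Longrightarrow> linear (g i)" "subspace K"
  shows "\<exists>E. finite E \<and> E \<subseteq> K \<and> (\<forall>y\<in>K. \<exists>y'\<in>span E. \<forall>i\<in>I. g i y' = g i y)"
  using assms
proof (induction I arbitrary: K rule: finite_induct)
  case empty
  show ?case by (intro exI[of _ "{}"]) auto
next
  case (insert j I)
  have lin: "linear (g j)" and linI: "\<And>i. i \<in> I \<Longrightarrow> linear (g i)" using insert.prems(1) by auto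
  define K' where "K' = K \<inter> {y. g j y = 0}"
  have "subspace K'"
    unfolding K'_def by (intro subspace_inter insert.prems(2) linear_subspace_kernel lin)
  from insert.IH[OF linI this] obtain E where E: "finite E" "E \<subseteq> K'"
    "\<And>y. y \<in> K' \<Longrightarrow> \<exists>y'\<in>span E. \<forall>i\<in>I. g i y' = g i y" by metis
  have "span E \<subseteq> K'" using E(2) \<open>subspace K'\<close> by (rule span_minimal)
  then have 0: "g j y = 0" if "y \<in> span E" for y using that by (auto simp: K'_def)
  show ?case
  proof (cases "\<exists>e\<in>K. g j e \<noteq> 0")
    case False
    then have "K' = K" by (auto simp: K'_def)
    then show ?thesis using E 0 False by (intro exI[of _ E]) fastforce
  next
    case True
    then obtain e where e: "e \<in> K" "g j e \<noteq> 0" by blast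
    have "\<exists>y'\<in>span (insert e E). \<forall>i\<in>insert j I. g i y' = g i y" if "y \<in> K" for y
    proof -
      define t where "t = g j y / g j e"
      have "y - t *\<^sub>R e \<in> K'"
        using that e insert.prems(2) lin
        by (simp add: K'_def t_def subspace_diff subspace_scale linear_diff linear_scale)
      from E(3)[OF this] obtain y' where
        y': "y' \<in> span E" "\<And>i. i \<in> I \<Longrightarrow> g i y' = g i (y - t *\<^sub>R e)" by blast
      have "g i (y' + t *\<^sub>R e) = g i y" if "i \<in> insert j I" for i
        using that y'(2) 0[OF y'(1)] e(2) insert.prems(1)[OF that]
        by (auto simp: linear_add linear_diff linear_scale t_def)
      moreover have "y' + t *\<^sub>R e \<in> span (insert e E)"
        using y'(1) by (auto simp: span_insert intro!: exI[of _ t])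
      ultimately show ?thesis by blast
    qed
    then show ?thesis
      using E(1,2) e(1) by (intro exI[of _ "insert e E"]) (auto simp: K'_def)
  qed
qed

text \<open>
  The vanishing of the combined functional on \<open>K\<close> is automatic: for \<open>y \<in> K\<close> the right-hand sides
  \<open>g i y\<close> and \<open>g i (- y)\<close> both admit solutions, hence satisfy the criterion.
\<close>

lemma eliminate_subspace:
  fixes g :: "'i \<Rightarrow> 'y::real_vector \<Rightarrow> real"
  assumes "finite I" "\<And>i. i \<in> I \<Longrightarrow> linear (g i)" "subspace K"
  obtains S :: "('i \<Rightarrow> real) set" where "finite S"
    "\<And>c. (\<exists>y\<in>K. \<forall>i\<in>I. g i y \<le> c i) \<longleftrightarrow> (\<forall>u\<in>S. 0 \<le> (\<Sum>i\<in>I. u i * c i))"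
    "\<And>u y. u \<in> S \<Longrightarrow> y \<in> K \<Longrightarrow> (\<Sum>i\<in>I. u i * g i y) = 0"
proof -
  obtain E where E: "finite E" "E \<subseteq> K" "\<And>y. y \<in> K \<Longrightarrow> \<exists>y'\<in>span E. \<forall>i\<in>I. g i y' = g i y"
    using finite_spanning_for_functionals[of I g K, OF assms] by blast
  obtain S :: "('i \<Rightarrow> real) set" where S: "finite S"
    "\<And>c. (\<exists>y\<in>span E. \<forall>i\<in>I. g i y \<le> c i) \<longleftrightarrow> (\<forall>u\<in>S. 0 \<le> (\<Sum>i\<in>I. u i * c i))"
    using eliminate_span[of I g E, OF assms(1,2) E(1)] by blast
  have "span E \<subseteq> K" using E(2) assms(3) by (rule span_minimal)
  then have eq: "(\<exists>y\<in>K. \<forall>i\<in>I. g i y \<le> c i) \<longleftrightarrow> (\<exists>y\<in>span E. \<forall>i\<in>I. g i y \<le> c i)" for c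
    using E(3) by (metis subsetD)
  have nonneg: "0 \<le> (\<Sum>i\<in>I. u i * g i y)" if "u \<in> S" "y \<in> K" for u y
    using that S(2)[of "\<lambda>i. g i y"] eq[of "\<lambda>i. g i y"] by blast
  have "(\<Sum>i\<in>I. u i * g i y) = 0" if "u \<in> S" "y \<in> K" for u y
  proof -
    have "(\<Sum>i\<in>I. u i * g i (- y)) = - (\<Sum>i\<in>I. u i * g i y)"
      using assms(2) by (simp add: linear_neg sum_negf)
    then show ?thesis
      using nonneg[OF that] nonneg[OF that(1) subspace_neg[OF assms(3) that(2)]] by simp
  qed
  then show thesis using S eq by (intro that[of S]) simp_all
qed

section \<open>Separation of a point from a closed subspace\<close>

lemma convex_coneI:
  assumes "\<And>x y. x \<in> S \<Longrightarrow> y \<in> S \<Longrightarrow> x + y \<in> S"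
    and "\<And>x c. x \<in> S \<Longrightarrow> 0 \<le> c \<Longrightarrow> c *\<^sub>R x \<in> S"
    and "0 \<in> S"
  shows "convex_cone S"
  unfolding convex_cone_iff by (intro conjI ballI allI impI assms)

text \<open>
  This is the use of Zorn's lemma behind the Hahn-Banach theorem. If neither \<open>w\<close> nor \<open>- w\<close> were
  in a maximal cone \<open>C\<close>, enlarging \<open>C\<close> by either would produce \<open>- v\<close>, and the positive combination
  of these two representations that cancels \<open>w\<close> would place \<open>- v\<close> in \<open>C\<close> itself.
\<close>

lemma maximal_convex_cone:
  fixes v :: "'a::real_vector"
  assumes "convex_cone C0" "- v \<notin> C0"
  obtains C where "convex_cone C" "C0 \<subseteq> C" "- v \<notin> C" "\<And>w. w \<in> C \<or> - w \<in> C"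
proof -
  let ?A = "{C. convex_cone C \<and> C0 \<subseteq> C \<and> - v \<notin> C}"
  have "\<exists>M\<in>?A. \<forall>X\<in>?A. M \<subseteq> X \<longrightarrow> X = M"
  proof (rule subset_Zorn_nonempty)
    show "?A \<noteq> {}" using assms by blast
  next
    fix \<C> assume C: "\<C> \<noteq> {}" "subset.chain ?A \<C>"
    then have sub: "\<C> \<subseteq> ?A" by (simp add: subset.chain_def)
    have "x + y \<in> \<Union>\<C>" if xy: "x \<in> \<Union>\<C>" "y \<in> \<Union>\<C>" for x y
    proof -
      obtain X Y where XY: "X \<in> \<C>" "Y \<in> \<C>" "x \<in> X" "y \<in> Y" using xy by blast
      then obtain M where "M \<in> \<C>" "x \<in> M" "y \<in> M"
        using C(2) by (metis subsetD subset_chain_def)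
      then show ?thesis using sub convex_cone_add[of M x y] by blast
    qed
    moreover have "c *\<^sub>R x \<in> \<Union>\<C>" if x: "x \<in> \<Union>\<C>" "0 \<le> c" for x c
    proof -
      obtain X where "X \<in> \<C>" "x \<in> X" using x(1) by blast
      then show ?thesis using sub convex_cone_scaleR[of X c x] x(2) by blast
    qed
    moreover have "0 \<in> \<Union>\<C>"
    proof -
      obtain X where "X \<in> \<C>" using C(1) by blast
      then show ?thesis using sub convex_cone_contains_0[of X] by blast
    qed
    ultimately have "convex_cone (\<Union>\<C>)" by (intro convex_coneI)
    then show "\<Union>\<C> \<in> ?A" using C(1) sub by blast
  qed
  then obtain C where C: "convex_cone C" "C0 \<subseteq> C" "- v \<notin> C"
    and max: "\<And>X. convex_cone X \<Longrightarrow> - v \<notin> X \<Longrightarrow> C \<subseteq> X \<Longrightarrow> X = C"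
    by (smt (verit) mem_Collect_eq subset_trans)
  have extend: "\<exists>c\<in>C. \<exists>a>0. - v = c + a *\<^sub>R w" if "w \<notin> C" for w
  proof -
    let ?X = "{c + a *\<^sub>R w | c a. c \<in> C \<and> 0 \<le> a}"
    have "x + y \<in> ?X" if "x \<in> ?X" "y \<in> ?X" for x y
    proof -
      obtain c a d b where "x = c + a *\<^sub>R w" "y = d + b *\<^sub>R w" "c \<in> C" "d \<in> C" "0 \<le> a" "0 \<le> b"
        using \<open>x \<in> ?X\<close> \<open>y \<in> ?X\<close> by auto
      then have "x + y = (c + d) + (a + b) *\<^sub>R w" "c + d \<in> C" "0 \<le> a + b"
        using C(1) by (auto simp: algebra_simps convex_cone_add)
      then show ?thesis by blast
    qed
    moreover have "r *\<^sub>R x \<in> ?X" if "x \<in> ?X" "0 \<le> r" for x r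
    proof -
      obtain c a where "x = c + a *\<^sub>R w" "c \<in> C" "0 \<le> a" using \<open>x \<in> ?X\<close> by auto
      then have "r *\<^sub>R x = r *\<^sub>R c + (r * a) *\<^sub>R w" "r *\<^sub>R c \<in> C" "0 \<le> r * a"
        using C(1) \<open>0 \<le> r\<close> by (auto simp: algebra_simps convex_cone_scaleR)
      then show ?thesis by blast
    qed
    moreover have sub: "C \<subseteq> ?X"
    proof
      fix c assume "c \<in> C"
      then show "c \<in> ?X" by (intro CollectI exI[of _ c] exI[of _ 0]) simp
    qed
    moreover have "0 \<in> ?X" using sub convex_cone_contains_0[OF C(1)] by blast
    ultimately have "convex_cone ?X" by (intro convex_coneI)
    moreover have "w \<in> ?X"
      using convex_cone_contains_0[OF C(1)] by (intro CollectI exI[of _ 0] exI[of _ 1]) simp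
    ultimately have "- v \<in> ?X" using max sub that by blast
    then obtain c a where ca: "- v = c + a *\<^sub>R w" "c \<in> C" "0 \<le> a" by blast
    then have "a \<noteq> 0" using C(3) by auto
    with ca show ?thesis by (metis less_eq_real_def)
  qed
  have "w \<in> C \<or> - w \<in> C" for w
  proof (rule ccontr)
    assume "\<not> (w \<in> C \<or> - w \<in> C)"
    then obtain c a d b where *: "c \<in> C" "0 < a" "- v = c + a *\<^sub>R w"
      "d \<in> C" "0 < b" "- v = d + b *\<^sub>R (- w)" using extend by metis
    have "(a + b) *\<^sub>R (- v) = b *\<^sub>R (c + a *\<^sub>R w) + a *\<^sub>R (d + b *\<^sub>R (- w))"
      by (simp only: flip: *(3) *(6)) (simp add: algebra_simps)
    also have "\<dots> = b *\<^sub>R c + a *\<^sub>R d" by (simp add: algebra_simps)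
    finally have "(1 / (a + b)) *\<^sub>R ((a + b) *\<^sub>R (- v)) = (1 / (a + b)) *\<^sub>R (b *\<^sub>R c + a *\<^sub>R d)"
      by simp
    moreover have "\<dots> \<in> C"
      using *(1,2,4,5) by (intro convex_cone_scaleR[OF C(1)] convex_cone_add[OF C(1)]) auto
    moreover have "(1 / (a + b)) *\<^sub>R ((a + b) *\<^sub>R (- v)) = - v" using *(2,5) by simp
    ultimately show False using C(3) by metis
  qed
  with C show thesis using that by blast
qed

text \<open>
  Such a cone is the nonnegative half-space of a functional up to its boundary: on each line in
  direction \<open>v\<close> it cuts out a half-line, and the position of the cut is linear. Superadditivity
  comes from \<open>C\<close> being a convex cone; oddness, hence additivity, holds because \<open>C\<close> meets each
  pair \<open>w\<close>, \<open>- w\<close> and omits \<open>- v\<close>.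
\<close>

lemma linear_functional_of_total_cone:
  fixes v :: "'a::real_vector"
  assumes C: "convex_cone C" "- v \<notin> C" "\<And>w. w \<in> C \<or> - w \<in> C"
    and absorb: "\<And>w. \<exists>t. w + t *\<^sub>R v \<in> C"
  obtains f :: "'a \<Rightarrow> real" where "linear f" "f v = 1" "\<And>w. w \<in> C \<Longrightarrow> 0 \<le> f w"
proof -
  define f where "f w = Sup {t. w - t *\<^sub>R v \<in> C}" for w
  have neg: "t \<ge> 0" if "t *\<^sub>R v \<in> C" for t
  proof (rule ccontr)
    assume "\<not> t \<ge> 0"
    then have "(1 / - t) *\<^sub>R (t *\<^sub>R v) \<in> C"
      using that \<open>\<not> t \<ge> 0\<close> by (intro convex_cone_scaleR[OF C(1) _ that]) simp
    then show False using C(2) \<open>\<not> t \<ge> 0\<close> by simp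
  qed
  have add: "s + t \<le> 0" if "w - s *\<^sub>R v \<in> C" "- w - t *\<^sub>R v \<in> C" for s t w
  proof -
    have "(w - s *\<^sub>R v) + (- w - t *\<^sub>R v) = (- (s + t)) *\<^sub>R v" by (simp add: algebra_simps)
    then show ?thesis using neg convex_cone_add[OF C(1) that] by force
  qed
  have ne: "{t. w - t *\<^sub>R v \<in> C} \<noteq> {}" for w
    using absorb[of w] by (metis diff_minus_eq_add empty_iff mem_Collect_eq scaleR_minus_left)
  have bdd: "bdd_above {t. w - t *\<^sub>R v \<in> C}" for w
  proof -
    obtain s where "- w - s *\<^sub>R v \<in> C" using ne[of "- w"] by blast
    then show ?thesis using add by (intro bdd_aboveI[of _ "- s"]) (force)
  qed
  have upper: "t \<le> f w" if "w - t *\<^sub>R v \<in> C" for t w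
    unfolding f_def using that bdd by (intro cSup_upper) auto
  have least: "f w \<le> r" if "\<And>t. w - t *\<^sub>R v \<in> C \<Longrightarrow> t \<le> r" for r w
    unfolding f_def using that ne by (intro cSup_least) auto
  have minus: "f (- w) = - f w" for w
  proof (rule antisym)
    show "f (- w) \<le> - f w"
    proof (rule least)
      fix t assume t: "- w - t *\<^sub>R v \<in> C"
      have "f w \<le> - t" using add[OF _ t] by (intro least) force
      then show "t \<le> - f w" by simp
    qed
    show "- f w \<le> f (- w)"
    proof (rule dense_ge)
      fix r assume "f (- w) < r"
      then have "- w - r *\<^sub>R v \<notin> C" using upper by force
      then have "w - (- r) *\<^sub>R v \<in> C" using C(3)[of "- w - r *\<^sub>R v"] by (simp add: add.commute)
      then have "- r \<le> f w" by (rule upper)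
      then show "- f w \<le> r" by simp
    qed
  qed
  have super: "f w + f x \<le> f (w + x)" for w x
  proof -
    have "t \<le> f (w + x) - s" if "w - t *\<^sub>R v \<in> C" "x - s *\<^sub>R v \<in> C" for s t
    proof -
      have "(w - t *\<^sub>R v) + (x - s *\<^sub>R v) = (w + x) - (t + s) *\<^sub>R v" by (simp add: algebra_simps)
      then show ?thesis using upper convex_cone_add[OF C(1) that] by (metis le_diff_eq)
    qed
    then have "f w \<le> f (w + x) - s" if "x - s *\<^sub>R v \<in> C" for s using that by (intro least)
    then have "s \<le> f (w + x) - f w" if "x - s *\<^sub>R v \<in> C" for s using that by force
    then have "f x \<le> f (w + x) - f w" by (intro least)
    then show ?thesis by simp
  qed
  have plus: "f (w + x) = f w + f x" for w x
    using super[of w x] super[of "- w" "- x"] minus[of w] minus[of x] minus[of "w + x"] by simp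
  have pos: "c * f w \<le> f (c *\<^sub>R w)" if "0 < c" for c w
  proof -
    have "t \<le> f (c *\<^sub>R w) / c" if "w - t *\<^sub>R v \<in> C" for t
    proof -
      have "c *\<^sub>R (w - t *\<^sub>R v) = c *\<^sub>R w - (c * t) *\<^sub>R v" by (simp add: algebra_simps)
      then have "c * t \<le> f (c *\<^sub>R w)"
        using upper convex_cone_scaleR[OF C(1) _ that, of c] \<open>0 < c\<close> by (metis less_imp_le)
      then show ?thesis using \<open>0 < c\<close> by (simp add: field_simps)
    qed
    then have "f w \<le> f (c *\<^sub>R w) / c" by (rule least)
    then show ?thesis using \<open>0 < c\<close> by (simp add: field_simps)
  qed
  have pos_eq: "f (c *\<^sub>R w) = c * f w" if "0 < c" for c w
    using pos[OF that, of w] pos[OF that, of "- w"] minus[of w] minus[of "c *\<^sub>R w"] by simp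
  have scale: "f (c *\<^sub>R w) = c * f w" for c w
  proof (cases c "0::real" rule: linorder_cases)
    case less
    then show ?thesis using pos_eq[of "- c" w] minus[of "c *\<^sub>R w"] by simp
  next
    case equal
    then show ?thesis using plus[of 0 0] by simp
  qed (rule pos_eq)
  have "linear f" using plus scale by (intro linearI) auto
  moreover have "f v = 1"
  proof (rule antisym)
    show "1 \<le> f v" using convex_cone_contains_0[OF C(1)] by (intro upper) simp
    show "f v \<le> 1"
    proof (rule least)
      fix t assume "v - t *\<^sub>R v \<in> C"
      then have "(1 - t) *\<^sub>R v \<in> C" by (simp add: algebra_simps)
      then show "t \<le> 1" using neg by force
    qed
  qed
  moreover have "0 \<le> f w" if "w \<in> C" for w using that by (intro upper) simp
  ultimately show thesis using that by blast
qed

lemma tendsto_scaleR_lcs: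
  fixes g :: "'b \<Rightarrow> 'a::locally_convex_space" and f :: "'b \<Rightarrow> real"
  assumes "(f \<longlongrightarrow> r) F" "(g \<longlongrightarrow> x) F"
  shows "((\<lambda>t. f t *\<^sub>R g t) \<longlongrightarrow> r *\<^sub>R x) F"
  using filterlim_compose[OF tendsto_scaleR_Pair_lcs filterlim_Pair[OF assms]] by simp

text \<open>
  A one-sided bound suffices, since applying it to \<open>u\<close> and \<open>- u\<close> bounds \<open>\<bar>f\<bar>\<close> near \<open>0\<close>.
\<close>

lemma linear_continuous_if_bounded_below:
  fixes f :: "'a::locally_convex_space \<Rightarrow> real"
  assumes "linear f" "open U" "0 \<in> U" "\<And>u. u \<in> U \<Longrightarrow> - 1 \<le> f u"
  shows "continuous_on UNIV f"
proof -
  have "(f \<longlongrightarrow> f x) (at x)" for x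
  proof (rule tendstoI)
    fix e :: real assume "0 < e"
    \<comment> \<open>The factor \<open>2\<close> turns the weak bound below into the strict one required.\<close>
    define c where "c = 2 / e"
    have "0 < c" using \<open>0 < e\<close> by (simp add: c_def)
    have "((\<lambda>y. c *\<^sub>R (y - x)) \<longlongrightarrow> c *\<^sub>R (x - x)) (at x)"
      "((\<lambda>y. c *\<^sub>R (x - y)) \<longlongrightarrow> c *\<^sub>R (x - x)) (at x)"
      by (intro tendsto_scaleR_lcs tendsto_intros)+
    then have "((\<lambda>y. c *\<^sub>R (y - x)) \<longlongrightarrow> 0) (at x)" "((\<lambda>y. c *\<^sub>R (x - y)) \<longlongrightarrow> 0) (at x)" by simp_all
    then have "\<forall>\<^sub>F y in at x. c *\<^sub>R (y - x) \<in> U" "\<forall>\<^sub>F y in at x. c *\<^sub>R (x - y) \<in> U"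
      using assms(2,3) by (auto dest: topological_tendstoD)
    then show "\<forall>\<^sub>F y in at x. dist (f y) (f x) < e"
    proof eventually_elim
      case (elim y)
      then have "- 1 \<le> c * (f y - f x)" "- 1 \<le> c * (f x - f y)"
        using assms(4)[of "c *\<^sub>R (y - x)"] assms(4)[of "c *\<^sub>R (x - y)"] assms(1)
        by (simp_all add: linear_scale linear_diff)
      then have "f x - f y \<le> e / 2" "f y - f x \<le> e / 2"
        using \<open>0 < e\<close> unfolding c_def by (simp_all add: field_simps)
      then have "\<bar>f y - f x\<bar> \<le> e / 2" by linarith
      then show ?case using \<open>0 < e\<close> by (simp add: dist_real_def)
    qed
  qed
  then show ?thesis by (simp add: continuous_on_def)
qed

text \<open>
  A convex neighbourhood \<open>v + U\<close> of \<open>v\<close> misses \<open>N\<close>. The cone generated by \<open>N\<close> and \<open>v + U\<close> then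
  omits \<open>- v\<close> and extends to a total cone, whose functional \<open>f\<close> is nonnegative on the subspace
  \<open>N\<close>, hence zero there, and nonnegative on \<open>v + U\<close>, hence at least \<open>- 1\<close> on \<open>U\<close> and continuous.
\<close>

lemma closed_subspace_separation:
  fixes v :: "'a::locally_convex_space"
  assumes N: "subspace N" "closed N" and "v \<notin> N"
  obtains f where "f \<in> topological_dual" "f v = 1" "\<And>w. w \<in> N \<Longrightarrow> f w = 0"
proof -
  have "open ((\<lambda>u. v + u) -` (- N))"
    using N(2) by (intro open_vimage continuous_intros) auto
  then obtain U where U: "convex U" "0 \<in> interior U" "U \<subseteq> (\<lambda>u. v + u) -` (- N)"
    using convex_nhds_zero[of "(\<lambda>u. v + u) -` (- N)"] \<open>v \<notin> N\<close> by auto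
  have "0 \<in> U" using U(2) interior_subset by blast
  let ?C0 = "{n + t *\<^sub>R (v + u) | n t u. n \<in> N \<and> 0 \<le> t \<and> u \<in> U}"
  have sub: "N \<subseteq> ?C0"
  proof
    fix n assume "n \<in> N"
    then show "n \<in> ?C0"
      using \<open>0 \<in> U\<close> by (intro CollectI exI[of _ n] exI[of _ 0] exI[of _ 0]) simp
  qed
  have U_C0: "v + u \<in> ?C0" if "u \<in> U" for u
    using that subspace_0[OF N(1)] by (intro CollectI exI[of _ 0] exI[of _ 1] exI[of _ u]) simp
  have "convex_cone ?C0"
  proof -
    have "x + y \<in> ?C0" if xy: "x \<in> ?C0" "y \<in> ?C0" for x y
    proof -
      obtain n t u n' t' u' where *: "x = n + t *\<^sub>R (v + u)" "n \<in> N" "0 \<le> t" "u \<in> U"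
        "y = n' + t' *\<^sub>R (v + u')" "n' \<in> N" "0 \<le> t'" "u' \<in> U" using xy by auto
      show ?thesis
      proof (cases "t + t' = 0")
        case True
        then have "t = 0" "t' = 0" using * by auto
        then have "x + y \<in> N" using * subspace_add[OF N(1)] by simp
        then show ?thesis using sub by blast
      next
        case False
        then have pos: "0 < t + t'" using * by simp
        define u'' where "u'' = (t / (t + t')) *\<^sub>R u + (t' / (t + t')) *\<^sub>R u'"
        have "u'' \<in> U"
          unfolding u''_def using * pos by (intro convexD[OF U(1)]) (simp_all flip: add_divide_distrib)
        moreover have "(t + t') *\<^sub>R u'' = t *\<^sub>R u + t' *\<^sub>R u'"
          using pos by (simp add: u''_def scaleR_add_right)
        then have "x + y = (n + n') + (t + t') *\<^sub>R (v + u'')"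
          by (simp add: * scaleR_add_right) (simp add: algebra_simps)
        ultimately show ?thesis using * pos subspace_add[OF N(1)] by fastforce
      qed
    qed
    moreover have "r *\<^sub>R x \<in> ?C0" if "x \<in> ?C0" "0 \<le> r" for x r
    proof -
      obtain n t u where *: "x = n + t *\<^sub>R (v + u)" "n \<in> N" "0 \<le> t" "u \<in> U"
        using \<open>x \<in> ?C0\<close> by auto
      then have "r *\<^sub>R x = r *\<^sub>R n + (r * t) *\<^sub>R (v + u)" "r *\<^sub>R n \<in> N" "0 \<le> r * t"
        using N(1) \<open>0 \<le> r\<close> by (simp_all add: scaleR_add_right subspace_scale)
      then show ?thesis using *(4) by blast
    qed
    moreover have "0 \<in> ?C0" using sub subspace_0[OF N(1)] by blast
    ultimately show ?thesis by (intro convex_coneI)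
  qed
  moreover have "- v \<notin> ?C0"
  proof
    \<comment> \<open>Otherwise division by \<open>1 + t\<close> yields a point of \<open>v + U\<close> in \<open>N\<close>, as \<open>U\<close> is star-shaped at \<open>0\<close>.\<close>
    assume "- v \<in> ?C0"
    then obtain n t u where *: "- v = n + t *\<^sub>R (v + u)" "n \<in> N" "0 \<le> t" "u \<in> U" by auto
    define s where "s = 1 / (1 + t)"
    have s: "0 \<le> s" "s * t \<le> 1" "s * (1 + t) = 1"
      using *(3) by (auto simp: s_def field_simps)
    have "(1 + t) *\<^sub>R v + t *\<^sub>R u = - n"
    proof -
      have n: "n = - v - t *\<^sub>R (v + u)" using *(1) by (simp add: algebra_simps)
      show ?thesis unfolding n by (simp add: algebra_simps)
    qed
    then have "s *\<^sub>R ((1 + t) *\<^sub>R v + t *\<^sub>R u) \<in> N"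
      using *(2) N(1) by (simp add: subspace_neg subspace_scale)
    then have "v + (s * t) *\<^sub>R u \<in> N"
      by (simp add: scaleR_add_right s(3))
    moreover have "(s * t) *\<^sub>R u \<in> U"
      using convexD[OF U(1) *(4) \<open>0 \<in> U\<close>, of "s * t" "1 - s * t"] s *(3) by simp
    ultimately show False using U(3) by auto
  qed
  ultimately obtain C where C: "convex_cone C" "?C0 \<subseteq> C" "- v \<notin> C" "\<And>w. w \<in> C \<or> - w \<in> C"
    by (rule maximal_convex_cone[of ?C0 v]) blast
  \<comment> \<open>\<open>v\<close> is interior to \<open>C\<close>, so \<open>v + s *\<^sub>R w\<close> is in \<open>C\<close> for small \<open>s > 0\<close>; rescale by \<open>1 / s\<close>.\<close>
  have "\<exists>t. w + t *\<^sub>R v \<in> C" for w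
  proof -
    have "((\<lambda>s. s *\<^sub>R w) \<longlongrightarrow> 0 *\<^sub>R w) (at_right (0::real))"
      by (intro tendsto_scaleR_lcs tendsto_intros)
    then have "\<forall>\<^sub>F s in at_right (0::real). s *\<^sub>R w \<in> interior U"
      using U(2) by (intro topological_tendstoD) auto
    moreover have "\<forall>\<^sub>F s in at_right (0::real). 0 < s" by (simp add: eventually_at_right_less)
    ultimately have "\<forall>\<^sub>F s in at_right (0::real). s *\<^sub>R w \<in> interior U \<and> 0 < s"
      by eventually_elim simp
    then obtain s :: real where s: "0 < s" "s *\<^sub>R w \<in> interior U"
      using eventually_happens[of _ "at_right (0::real)"] by auto
    then have "v + s *\<^sub>R w \<in> C" using U_C0 C(2) interior_subset by blast
    then have "(1 / s) *\<^sub>R (v + s *\<^sub>R w) \<in> C" using s(1) C(1) by (intro convex_cone_scaleR) auto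
    moreover have "(1 / s) *\<^sub>R (v + s *\<^sub>R w) = w + (1 / s) *\<^sub>R v"
      using s(1) by (simp add: scaleR_add_right)
    ultimately show ?thesis by metis
  qed
  then obtain f :: "'a \<Rightarrow> real" where f: "linear f" "f v = 1" "\<And>w. w \<in> C \<Longrightarrow> 0 \<le> f w"
    using linear_functional_of_total_cone[OF C(1,3,4)] by metis
  have "f w = 0" if "w \<in> N" for w
  proof -
    have "w \<in> C" "- w \<in> C" using that subspace_neg[OF N(1)] sub C(2) by blast+
    then show ?thesis using f(3)[of w] f(3)[of "- w"] linear_neg[OF f(1), of w] by simp
  qed
  moreover have "continuous_on UNIV f"
  proof (rule linear_continuous_if_bounded_below[OF f(1)])
    show "open (interior U)" "0 \<in> interior U" using U(2) by auto
    fix u assume "u \<in> interior U"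
    then have "v + u \<in> C" using U_C0 C(2) interior_subset by blast
    then show "- 1 \<le> f u" using f(3)[of "v + u"] f(2) linear_add[OF f(1), of v u] by simp
  qed
  ultimately show thesis
    using that f by (auto simp: topological_dual_def continuous_linear_def)
qed

section \<open>Functionals that factor through the mapping\<close>

lemma finite_codimension_kernel:
  fixes \<phi> :: "'a::real_vector \<Rightarrow> real"
  assumes "linear \<phi>"
  shows "finite_codimension {y. \<phi> y = 0}"
proof -
  have sub: "subspace {y. \<phi> y = 0}" by (rule linear_subspace_kernel[OF assms])
  show ?thesis
  proof (cases "\<forall>y. \<phi> y = 0")
    case True
    then show ?thesis unfolding finite_codimension_iff_span[OF sub]
      by (intro exI[of _ "{}"]) simp
  next
    case False
    then obtain e where e: "\<phi> e \<noteq> 0" by blast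
    have "y \<in> span ({y. \<phi> y = 0} \<union> {e})" for y
    proof -
      have "y - (\<phi> y / \<phi> e) *\<^sub>R e \<in> span {y. \<phi> y = 0}"
        using e assms by (intro span_base) (simp add: linear_diff linear_scale)
      then show ?thesis by (auto simp: span_insert)
    qed
    then show ?thesis unfolding finite_codimension_iff_span[OF sub]
      by (intro exI[of _ "{e}"]) blast
  qed
qed

text \<open>
  The functional induced by \<open>\<phi>\<close> on the range of \<open>A\<close> has as kernel the image of the kernel of
  \<open>\<phi>\<close>, which is closed by the hypothesis on \<open>A\<close>. A continuous \<open>\<nu>\<close> that vanishes on this image
  and equals \<open>1\<close> at a point \<open>A e\<close> with \<open>\<phi> e \<noteq> 0\<close> therefore agrees with the induced functional up to
  the factor \<open>\<phi> e\<close>.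
\<close>

lemma functional_factors_through:
  fixes A :: "'y::locally_convex_space \<Rightarrow> 'z::locally_convex_space"
  assumes "linear A" "closed_under_finite_codim A" "\<phi> \<in> topological_dual"
    and ker: "\<And>y. A y = 0 \<Longrightarrow> \<phi> y = 0"
  obtains \<mu> where "\<mu> \<in> topological_dual" "\<And>y. \<mu> (A y) = \<phi> y"
proof (cases "\<forall>y. \<phi> y = 0")
  case True
  have "(\<lambda>_. 0) \<in> topological_dual"
    by (auto simp: topological_dual_def continuous_linear_def linear_zero)
  then show thesis using that True by metis
next
  case False
  have \<phi>: "linear \<phi>" "continuous_on UNIV \<phi>"
    using assms(3) by (auto simp: topological_dual_def continuous_linear_def)
  obtain e where e: "\<phi> e \<noteq> 0" using False by blast
  let ?W = "{y. \<phi> y = 0}"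
  have sub: "subspace ?W" by (rule linear_subspace_kernel[OF \<phi>(1)])
  have "closed ?W" by (intro closed_Collect_eq \<phi>(2) continuous_on_const)
  then have "closed (A ` ?W)"
    using assms(2) sub finite_codimension_kernel[OF \<phi>(1)]
    by (auto simp: closed_under_finite_codim_def)
  moreover have "subspace (A ` ?W)"
    using assms(1) sub by (rule linear_subspace_image)
  moreover have "A e \<notin> A ` ?W"
  proof
    assume "A e \<in> A ` ?W"
    then obtain y where "A e = A y" "\<phi> y = 0" by blast
    then have "A (e - y) = 0" using assms(1) by (simp add: linear_diff)
    then have "\<phi> (e - y) = 0" by (rule ker)
    then show False using e \<open>\<phi> y = 0\<close> \<phi>(1) by (simp add: linear_diff)
  qed
  ultimately obtain \<nu> where \<nu>: "\<nu> \<in> topological_dual" "\<nu> (A e) = 1"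
    "\<And>w. w \<in> A ` ?W \<Longrightarrow> \<nu> w = 0"
    using closed_subspace_separation[of "A ` ?W" "A e"] by blast
  have \<nu>_lin: "linear \<nu>" and \<nu>_cont: "continuous_on UNIV \<nu>"
    using \<nu>(1) by (auto simp: topological_dual_def continuous_linear_def)
  have "\<phi> e * \<nu> (A y) = \<phi> y" for y
  proof -
    have "y - (\<phi> y / \<phi> e) *\<^sub>R e \<in> ?W" using e \<phi>(1) by (simp add: linear_diff linear_scale)
    then have "\<nu> (A (y - (\<phi> y / \<phi> e) *\<^sub>R e)) = 0" using \<nu>(3) by blast
    then show ?thesis using e \<nu>(2) \<nu>_lin assms(1) by (simp add: linear_diff linear_scale)
  qed
  moreover have "(\<lambda>w. \<phi> e * \<nu> w) \<in> topological_dual"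
    using \<nu>_lin \<nu>_cont
    by (auto simp: topological_dual_def continuous_linear_def linear_iff algebra_simps
        intro!: continuous_intros)
  ultimately show thesis using that by blast
qed

section \<open>The domain of a generalized polyhedral convex multifunction\<close>

lemma generalized_polyhedral_convexI:
  assumes "finite J" "\<And>j. j \<in> J \<Longrightarrow> f j \<in> topological_dual" "affine L" "closed L"
  shows "generalized_polyhedral_convex {x \<in> L. \<forall>j\<in>J. f j x \<le> \<alpha> j}"
proof -
  obtain h and k :: nat where J: "J = h ` {1..k}"
    using ex_bij_betw_nat_finite_1[OF assms(1)] by (metis bij_betw_imp_surj_on)
  then have "f (h i) \<in> topological_dual" if "i \<in> {1..k}" for i
    using that assms(2) by blast
  moreover have "{x \<in> L. \<forall>j\<in>J. f j x \<le> \<alpha> j} =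
      {x. x \<in> L \<and> (\<forall>i\<in>{1..k}. f (h i) x \<le> \<alpha> (h i))}"
    unfolding J by blast
  ultimately show ?thesis
    unfolding generalized_polyhedral_convex_def using assms(3,4)
    by (intro exI[of _ k] exI[of _ "\<lambda>i. f (h i)"] exI[of _ "\<lambda>i. \<alpha> (h i)"] exI[of _ L]) blast
qed

lemma topological_dual_sum:
  assumes "\<And>i. i \<in> I \<Longrightarrow> f i \<in> topological_dual"
  shows "(\<lambda>x. \<Sum>i\<in>I. u i * f i x) \<in> topological_dual"
proof -
  have lin: "linear (f i)" and cont: "continuous_on UNIV (f i)" if "i \<in> I" for i
    using assms[OF that] by (auto simp: topological_dual_def continuous_linear_def)
  have "linear (\<lambda>x. \<Sum>i\<in>I. u i * f i x)"
    by (rule linearI)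
      (simp_all add: linear_add[OF lin] linear_scale[OF lin] distrib_left sum.distrib
        sum_distrib_left mult.left_commute)
  then show ?thesis
    using cont by (auto simp: topological_dual_def continuous_linear_def intro!: continuous_intros)
qed

theorem theorem3p1:
  fixes F :: "'x::locally_convex_space \<Rightarrow> 'y::locally_convex_space set"
    and A\<^sub>1 :: "'x \<Rightarrow> 'z::locally_convex_space"
    and A\<^sub>2 :: "'y \<Rightarrow> 'z"
    and z :: 'z
    and m :: nat
    and x' :: "nat \<Rightarrow> 'x \<Rightarrow> real"
    and y' :: "nat \<Rightarrow> 'y \<Rightarrow> real"
    and \<beta> :: "nat \<Rightarrow> real"
  assumes "continuous_linear A\<^sub>1"
    and "continuous_linear A\<^sub>2"
    and "\<And>i. i \<in> {1..m} \<Longrightarrow> x' i \<in> topological_dual"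
    and "\<And>i. i \<in> {1..m} \<Longrightarrow> y' i \<in> topological_dual"
    and "gph F = {(x, y). A\<^sub>1 x + A\<^sub>2 y = z \<and> (\<forall>i\<in>{1..m}. x' i x + y' i y \<le> \<beta> i)}"
    and "closed_under_finite_codim A\<^sub>2"
  shows "generalized_polyhedral_convex (mdom F)"
proof -
  have A1: "linear A\<^sub>1" "continuous_on UNIV A\<^sub>1" and A2: "linear A\<^sub>2"
    using assms(1,2) by (auto simp: continuous_linear_def)
  define K where "K = {y. A\<^sub>2 y = 0}"
  have K: "subspace K" unfolding K_def by (rule linear_subspace_kernel[OF A2])
  have y'_lin: "linear (y' i)" if "i \<in> {1..m}" for i
    using assms(4)[OF that] by (simp add: topological_dual_def continuous_linear_def)
  obtain S :: "(nat \<Rightarrow> real) set" where S: "finite S"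
    "\<And>c. (\<exists>y\<in>K. \<forall>i\<in>{1..m}. y' i y \<le> c i) \<longleftrightarrow> (\<forall>u\<in>S. 0 \<le> (\<Sum>i\<in>{1..m}. u i * c i))"
    "\<And>u y. u \<in> S \<Longrightarrow> y \<in> K \<Longrightarrow> (\<Sum>i\<in>{1..m}. u i * y' i y) = 0"
    using eliminate_subspace[of "{1..m}" y' K, OF finite_atLeastAtMost y'_lin K] by blast
  have "\<exists>\<mu>. \<mu> \<in> topological_dual \<and> (\<forall>y. \<mu> (A\<^sub>2 y) = (\<Sum>i\<in>{1..m}. u i * y' i y))" if "u \<in> S" for u
  proof -
    have "(\<Sum>i\<in>{1..m}. u i * y' i y) = 0" if "A\<^sub>2 y = 0" for y
      using S(3)[OF \<open>u \<in> S\<close>] that by (simp add: K_def)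
    then show ?thesis
      using functional_factors_through[OF A2 assms(6) topological_dual_sum[of "{1..m}" y' u, OF assms(4)]]
      by blast
  qed
  then obtain \<mu> where \<mu>: "\<And>u. u \<in> S \<Longrightarrow> \<mu> u \<in> topological_dual"
    "\<And>u y. u \<in> S \<Longrightarrow> \<mu> u (A\<^sub>2 y) = (\<Sum>i\<in>{1..m}. u i * y' i y)" by metis
  define L where "L = {x. z - A\<^sub>1 x \<in> range A\<^sub>2}"
  define f where "f u x = (\<Sum>i\<in>{1..m}. u i * x' i x) - \<mu> u (A\<^sub>1 x)" for u x
  define \<alpha> where "\<alpha> u = (\<Sum>i\<in>{1..m}. u i * \<beta> i) - \<mu> u z" for u
  have dom: "x \<in> mdom F \<longleftrightarrow> (\<exists>y. A\<^sub>1 x + A\<^sub>2 y = z \<and> (\<forall>i\<in>{1..m}. x' i x + y' i y \<le> \<beta> i))" for x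
    using assms(5) by (auto simp: mdom_def gph_def set_eq_iff)
  \<comment> \<open>Substituting \<open>\<mu> u (z - A\<^sub>1 x)\<close> for the functional of \<open>y0\<close> and collecting the terms in \<open>x\<close>
      gives \<open>f\<close> and \<open>\<alpha>\<close>.\<close>
  have "x \<in> mdom F \<longleftrightarrow> x \<in> L \<and> (\<forall>u\<in>S. f u x \<le> \<alpha> u)" for x
  proof (cases "x \<in> L")
    case False
    have "z - A\<^sub>1 x = A\<^sub>2 y" if "A\<^sub>1 x + A\<^sub>2 y = z" for y using that by (simp add: algebra_simps flip: that)
    then have "x \<notin> mdom F" using False unfolding dom L_def by blast
    with False show ?thesis by blast
  next
    case True
    then obtain y0 where y0: "z - A\<^sub>1 x = A\<^sub>2 y0" by (auto simp: L_def)
    have "x \<in> mdom F \<longleftrightarrow> (\<exists>y\<in>K. \<forall>i\<in>{1..m}. y' i y \<le> \<beta> i - x' i x - y' i y0)"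
    proof
      assume "x \<in> mdom F"
      then obtain y where y: "A\<^sub>1 x + A\<^sub>2 y = z" "\<And>i. i \<in> {1..m} \<Longrightarrow> x' i x + y' i y \<le> \<beta> i"
        unfolding dom by blast
      have "y' i (y - y0) \<le> \<beta> i - x' i x - y' i y0" if "i \<in> {1..m}" for i
        using y(2)[OF that] linear_diff[OF y'_lin[OF that], of y y0] by simp
      moreover have "y - y0 \<in> K"
        unfolding K_def using y(1) A2 by (simp add: linear_diff flip: y0) (simp add: algebra_simps)
      ultimately show "\<exists>y\<in>K. \<forall>i\<in>{1..m}. y' i y \<le> \<beta> i - x' i x - y' i y0" by blast
    next
      assume "\<exists>y\<in>K. \<forall>i\<in>{1..m}. y' i y \<le> \<beta> i - x' i x - y' i y0"
      then obtain y where y: "y \<in> K" "\<And>i. i \<in> {1..m} \<Longrightarrow> y' i y \<le> \<beta> i - x' i x - y' i y0" by blast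
      have "x' i x + y' i (y + y0) \<le> \<beta> i" if "i \<in> {1..m}" for i
        using y(2)[OF that] linear_add[OF y'_lin[OF that], of y y0] by simp
      moreover have "A\<^sub>1 x + A\<^sub>2 (y + y0) = z"
        using y(1) A2 by (simp add: K_def linear_add flip: y0)
      ultimately show "x \<in> mdom F" unfolding dom by blast
    qed
    also have "\<dots> \<longleftrightarrow> (\<forall>u\<in>S. 0 \<le> (\<Sum>i\<in>{1..m}. u i * (\<beta> i - x' i x - y' i y0)))"
      by (rule S(2))
    also have "\<dots> \<longleftrightarrow> (\<forall>u\<in>S. f u x \<le> \<alpha> u)"
    proof (rule ball_cong[OF refl])
      fix u assume u: "u \<in> S"
      have "(\<Sum>i\<in>{1..m}. u i * y' i y0) = \<mu> u (z - A\<^sub>1 x)" using \<mu>(2)[OF u] y0 by simp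
      also have "\<dots> = \<mu> u z - \<mu> u (A\<^sub>1 x)"
        using \<mu>(1)[OF u] by (simp add: topological_dual_def continuous_linear_def linear_diff)
      finally show "0 \<le> (\<Sum>i\<in>{1..m}. u i * (\<beta> i - x' i x - y' i y0)) \<longleftrightarrow> f u x \<le> \<alpha> u"
        by (simp add: f_def \<alpha>_def right_diff_distrib sum_subtractf) linarith
    qed
    finally show ?thesis using True by simp
  qed
  then have eq: "mdom F = {x \<in> L. \<forall>u\<in>S. f u x \<le> \<alpha> u}" by blast
  have range: "subspace (range A\<^sub>2)" "closed (range A\<^sub>2)"
  proof -
    show "subspace (range A\<^sub>2)" using A2 subspace_UNIV by (rule linear_subspace_image)
    have "finite_codimension (UNIV :: 'y set)"
      using finite_codimension_kernel[of "\<lambda>_. 0"] by (simp add: linear_zero)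
    then show "closed (range A\<^sub>2)"
      using assms(6) by (simp add: closed_under_finite_codim_def)
  qed
  have "affine L"
    unfolding affine_def
  proof (intro ballI allI impI)
    fix x y and a b :: real
    assume xy: "x \<in> L" "y \<in> L" and ab: "a + b = 1"
    have "z - A\<^sub>1 (a *\<^sub>R x + b *\<^sub>R y) = a *\<^sub>R (z - A\<^sub>1 x) + b *\<^sub>R (z - A\<^sub>1 y)"
    proof -
      have "a *\<^sub>R z + b *\<^sub>R z = z" using ab by (simp flip: scaleR_add_left)
      then show ?thesis
        using A1(1) by (simp add: linear_add linear_scale scaleR_diff_right)
    qed
    also have "\<dots> \<in> range A\<^sub>2"
      using xy range(1) by (auto simp: L_def intro!: subspace_add subspace_scale)
    finally show "a *\<^sub>R x + b *\<^sub>R y \<in> L" by (simp add: L_def)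
  qed
  moreover have "closed L"
  proof -
    have "closed ((\<lambda>x. z - A\<^sub>1 x) -` range A\<^sub>2)"
      using range(2) A1(2) by (intro closed_vimage continuous_intros)
    then show ?thesis by (simp add: L_def vimage_def)
  qed
  moreover have "f u \<in> topological_dual" if "u \<in> S" for u
  proof -
    have "(\<lambda>x. \<Sum>i\<in>{1..m}. u i * x' i x) \<in> topological_dual"
      by (rule topological_dual_sum) (rule assms(3))
    then have s: "linear (\<lambda>x. \<Sum>i\<in>{1..m}. u i * x' i x)"
      "continuous_on UNIV (\<lambda>x. \<Sum>i\<in>{1..m}. u i * x' i x)"
      by (simp_all add: topological_dual_def continuous_linear_def)
    have m: "linear (\<mu> u)" "continuous_on UNIV (\<mu> u)"
      using \<mu>(1)[OF that] by (simp_all add: topological_dual_def continuous_linear_def)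
    have "linear (\<lambda>x. \<mu> u (A\<^sub>1 x))"
      using linear_compose[OF A1(1) m(1)] by (simp add: o_def)
    moreover have "continuous_on UNIV (\<lambda>x. \<mu> u (A\<^sub>1 x))"
      by (rule continuous_on_compose2[OF m(2) A1(2)]) simp
    ultimately show ?thesis
      unfolding f_def[abs_def] topological_dual_def continuous_linear_def
      using s by (auto intro: linear_compose_sub continuous_on_diff)
  qed
  ultimately show ?thesis
    unfolding eq by (intro generalized_polyhedral_convexI S(1))
qed

end
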